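(* For each $M\in\{1,2,3,4\}$, the sequence $(C_M^N)_{N\ge 1}$ is semicomplete, where $C_M^N$ denotes the maximum number of pieces into which an $M$-dimensional hypercube can be cut using $N-1$ hyperplanes.
   Context: Equivalently, $C_M^N=\sum_{i=0}^{M}\binom{N-1}{i}$; it satisfies $C_M^1=1$ and $C_M^N=C_M^{N-1}+C_{M-1}^{N-1}$. Explicitly $C_1^N=N$, $C_2^N=\frac{N^2-N+2}{2}$ (lazy caterer's sequence), $C_3^N=\frac{N^3-3N^2+8N}{6}$ (cake numbers), $C_4^N=\frac{N^4-6N^3+23N^2-18N+24}{24}$. A sequence $(n_i)_{i\ge1}$ of integers is called semicomplete if all its terms are positive, it is strictly increasing, and the following holds: for every integer $j>2$, letting $G_j=\frac{n_1}{j}+\cdots+\frac{n_j}{j}$, every positive integer $k<\lfloor G_j\rfloor$ can be written as $k=\frac{a_1}{j}+\cdots+\frac{a_m}{j}$ where $a_1,\ldots,a_m$ are distinct elements of $\{n_1,\ldots,n_j\}$. *)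

theory Defs
  imports "HOL-Analysis.Analysis"
begin

definition hyperplane :: "'a::euclidean_space set \<Rightarrow> bool" where
  "hyperplane H \<longleftrightarrow> (\<exists>a b. a \<noteq> 0 \<and> H = {x. a \<bullet> x = b})"

definition pieces :: "'a::euclidean_space set \<Rightarrow> 'a set set \<Rightarrow> 'a set set" where
  "pieces Q \<H> = components (Q - \<Union>\<H>)"

(* The dimension M is CARD('n), and cbox 0 1 is the closed unit hypercube in R^M.
   The sequence is meant for N >= 1, so that N - 1 does not truncate. Finiteness of \<H>
   is explicit because an infinite set has card 0. *)
definition max_pieces :: "'n::finite itself \<Rightarrow> nat \<Rightarrow> nat" where
  "max_pieces _ N =
     Max {card (pieces (cbox 0 (1 :: real ^ 'n)) \<H>) | \<H>.
            finite \<H> \<and> card \<H> = N - 1 \<and> (\<forall>H\<in>\<H>. hyperplane H)}"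

(* Sequences are indexed from 1; the value at 0 is irrelevant. *)
definition semicomplete :: "(nat \<Rightarrow> int) \<Rightarrow> bool" where
  "semicomplete n \<longleftrightarrow>
     (\<forall>i\<ge>1. n i > 0) \<and>
     strict_mono_on {1..} n \<and>
     (\<forall>j>2. \<forall>k::int. 0 < k \<and> k < \<lfloor>\<Sum>i=1..j. real_of_int (n i) / real j\<rfloor> \<longrightarrow>
        (\<exists>A \<subseteq> n ` {1..j}. real_of_int k = (\<Sum>a\<in>A. real_of_int a / real j)))"

end

theory Submission
  imports Defs
begin

text \<open>
  The closed formula for the number of pieces is not needed. Write \<open>m N\<close> for the maximum over
  arrangements of \<open>N - 1\<close> hyperplanes. Every piece is convex, so a further hyperplane cuts it into at
  most two, whence \<open>m (N + 1) \<le> 2 * m N\<close>; and a hyperplane through an interior point of a piece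
  genuinely cuts that piece while destroying no other, whence \<open>m N < m (N + 1)\<close>. Together with
  \<open>m 1 = 1\<close>, the doubling bound gives \<open>m (N + 1) \<le> 1 + (m 1 + \<dots> + m N)\<close>, so the greedy
  algorithm represents every integer between \<open>0\<close> and \<open>m 1 + \<dots> + m N\<close> as a sum of distinct
  terms.
\<close>

section \<open>Subset sums of sequences that at most double\<close>

lemma le_Suc_sum_of_doubling:
  fixes f :: "nat \<Rightarrow> int"
  assumes "f 1 = 1" and "\<And>i. i \<ge> 1 \<Longrightarrow> f (Suc i) \<le> 2 * f i"
  shows "f (Suc j) \<le> 1 + (\<Sum>i=1..j. f i)"
proof (induction j)
  case 0
  then show ?case using assms(1) by simp
next
  case (Suc j)
  then show ?case using assms(2)[of "Suc j"] by simp
qed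

text \<open>Greedy choice from the top: the last term is used exactly when \<open>k\<close> exceeds
  the sum of the earlier ones. Index sets are used here; distinctness of the values comes later,
  from monotonicity.\<close>

lemma subset_sum_of_doubling:
  fixes f :: "nat \<Rightarrow> int"
  assumes "f 1 = 1" and "\<And>i. i \<ge> 1 \<Longrightarrow> f (Suc i) \<le> 2 * f i"
    and "0 \<le> k" "k \<le> (\<Sum>i=1..j. f i)"
  shows "\<exists>I\<subseteq>{1..j}. k = (\<Sum>i\<in>I. f i)"
  using assms(3,4)
proof (induction j arbitrary: k)
  case 0
  then show ?case by auto
next
  case (Suc j)
  show ?case
  proof (cases "k \<le> (\<Sum>i=1..j. f i)")
    case True
    with Suc.IH Suc.prems obtain I where "I \<subseteq> {1..j}" "k = (\<Sum>i\<in>I. f i)"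
      by blast
    then show ?thesis
      by (intro exI[of _ I]) auto
  next
    case False
    \<comment> \<open>Here \<open>k\<close> is at least one more than the sum of the earlier terms,
      which bounds \<open>f (Suc j)\<close>.\<close>
    then have "0 \<le> k - f (Suc j)"
      using le_Suc_sum_of_doubling[of f j, OF assms(1,2)] by simp
    moreover have "k - f (Suc j) \<le> (\<Sum>i=1..j. f i)"
      using Suc.prems by simp
    ultimately obtain I where I: "I \<subseteq> {1..j}" "k - f (Suc j) = (\<Sum>i\<in>I. f i)"
      using Suc.IH by blast
    have "finite I" "Suc j \<notin> I"
      using I(1) finite_subset by auto
    then have "k = (\<Sum>i\<in>insert (Suc j) I. f i)"
      using I(2) by simp
    moreover have "insert (Suc j) I \<subseteq> {1..Suc j}"
      using I(1) by auto
    ultimately show ?thesis by blast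
  qed
qed

lemma semicomplete_of_doubling:
  fixes f :: "nat \<Rightarrow> int"
  assumes one: "f 1 = 1"
    and double: "\<And>i. i \<ge> 1 \<Longrightarrow> f (Suc i) \<le> 2 * f i"
    and less: "\<And>i. i \<ge> 1 \<Longrightarrow> f i < f (Suc i)"
  shows "semicomplete f"
proof -
  have mono: "strict_mono_on {1..} f"
  proof (rule strict_mono_onI)
    fix r s :: nat
    assume "r \<in> {1..}" "r < s"
    from \<open>r < s\<close> \<open>r \<in> {1..}\<close> show "f r < f s"
    proof (induction rule: strict_inc_induct)
      case (base i)
      then show ?case using less by simp
    next
      case (step i)
      then show ?case using less[of i] by force
    qed
  qed
  have pos: "f i > 0" if "i \<ge> 1" for i
  proof (cases "i = 1")
    case False
    then have "f 1 < f i"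
      using that by (intro strict_mono_onD[OF mono]) auto
    then show ?thesis using one by simp
  qed (use one in simp)
  have "\<exists>A \<subseteq> f ` {1..j}. real_of_int k = (\<Sum>a\<in>A. real_of_int a / real j)"
    if j: "j > 2" and k: "0 < k" "k < \<lfloor>\<Sum>i=1..j. real_of_int (f i) / real j\<rfloor>" for j k
  proof -
    have "real_of_int k \<le> (\<Sum>i=1..j. real_of_int (f i) / real j)"
      using k(2) by linarith
    \<comment> \<open>Clearing the denominator leaves an integer subset-sum problem with target
      \<open>k * int j\<close>.\<close>
    then have "real_of_int k * real j \<le> (\<Sum>i=1..j. real_of_int (f i))"
      using j by (simp add: sum_divide_distrib[symmetric] pos_le_divide_eq)
    then have "real_of_int (k * int j) \<le> real_of_int (\<Sum>i=1..j. f i)"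
      by simp
    then have "k * int j \<le> (\<Sum>i=1..j. f i)"
      by (simp only: of_int_le_iff)
    then obtain I where I: "I \<subseteq> {1..j}" "k * int j = (\<Sum>i\<in>I. f i)"
      using subset_sum_of_doubling[of f "k * int j" j, OF one double] k(1) by auto
    have "inj_on f I"
      using I(1) by (intro inj_on_subset[OF strict_mono_on_imp_inj_on[OF mono]]) auto
    then have "(\<Sum>a\<in>f ` I. real_of_int a / real j) = (\<Sum>i\<in>I. real_of_int (f i)) / real j"
      by (simp add: sum.reindex sum_divide_distrib)
    also have "\<dots> = real_of_int (k * int j) / real j"
      by (simp only: I(2) of_int_sum)
    also have "\<dots> = real_of_int k"
      using j by simp
    finally show ?thesis
      using I(1) by (intro exI[of _ "f ` I"]) auto
  qed
  with pos mono show ?thesis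
    unfolding semicomplete_def by blast
qed

section \<open>Cutting convex pieces by a hyperplane\<close>

text \<open>Each member is clopen in \<open>S\<close>, so a connected set containing it cannot be
  larger. As the members cover \<open>S\<close>, every component meets one of them and hence equals
  it.\<close>

lemma components_eqI:
  assumes S: "\<Union>F = S"
    and disj: "pairwise disjnt F"
    and F: "\<And>C. C \<in> F \<Longrightarrow> openin (top_of_set S) C \<and> connected C \<and> C \<noteq> {}"
  shows "components S = F"
proof -
  have comp: "C \<in> components S" if C: "C \<in> F" for C
    unfolding in_components_maximal
  proof (intro conjI allI impI)
    show "C \<noteq> {}" "C \<subseteq> S" "connected C"
      using F C S by auto
    fix D
    assume D: "D \<noteq> {} \<and> C \<subseteq> D \<and> D \<subseteq> S \<and> connected D"
    \<comment> \<open>The complement of \<open>C\<close> is a union of open members, so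
      \<open>C\<close> is closed too.\<close>
    have "S - C = \<Union>(F - {C})"
      using S disj C by (auto simp: pairwise_def disjnt_def)
    moreover have "openin (top_of_set S) (\<Union>(F - {C}))"
      using F by (intro openin_Union) auto
    ultimately have "closedin (top_of_set S) C"
      using C S by (auto simp: closedin_def)
    then have "closedin (top_of_set D) C"
      using D closedin_subset_trans by blast
    moreover have "openin (top_of_set D) C"
      using D F[OF C] openin_subset_trans by blast
    ultimately show "D = C"
      using D F[OF C] by (auto simp: connected_clopen)
  qed
  moreover have "D \<in> F" if D: "D \<in> components S" for D
  proof -
    obtain x where x: "x \<in> D"
      using in_components_nonempty[OF D] by blast
    then obtain C where C: "C \<in> F" "x \<in> C"
      using S in_components_subset[OF D] by blast
    then have "D = C"
      using components_eq[OF D comp[OF C(1)]] x by blast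
    then show ?thesis using C by simp
  qed
  ultimately show ?thesis by blast
qed

text \<open>Dropping the empty set makes the cardinality count actual pieces: a convex
  \<open>C\<close> missed by the hyperplane yields just \<open>{C}\<close>.\<close>

definition cut :: "'a::real_inner \<Rightarrow> real \<Rightarrow> 'a set \<Rightarrow> 'a set set" where
  "cut a b C = {C \<inter> {x. a \<bullet> x < b}, C \<inter> {x. a \<bullet> x > b}} - {{}}"

lemma finite_cut [simp]: "finite (cut a b C)"
  by (simp add: cut_def)

lemma card_cut_le: "card (cut a b C) \<le> 2"
proof -
  have "card (cut a b C) \<le> card {C \<inter> {x. a \<bullet> x < b}, C \<inter> {x. a \<bullet> x > b}}"
    unfolding cut_def by (intro card_mono) auto
  also have "\<dots> \<le> 2"
    by (simp add: card_insert_if)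
  finally show ?thesis .
qed

lemma Union_cut: "\<Union>(cut a b C) = C - {x. a \<bullet> x = b}"
proof -
  have "\<Union>(cut a b C) = C \<inter> {x. a \<bullet> x < b} \<union> C \<inter> {x. a \<bullet> x > b}"
    unfolding cut_def by blast
  also have "\<dots> = C - {x. a \<bullet> x = b}"
    by (auto simp: neq_iff)
  finally show ?thesis .
qed

lemma cutD:
  assumes "D \<in> cut a b C"
  shows "D \<noteq> {}" "D \<subseteq> C" and "convex C \<Longrightarrow> convex D"
    and "openin (top_of_set Q) C \<Longrightarrow> openin (top_of_set Q) D"
proof -
  obtain T where T: "D = C \<inter> T" "T = {x. a \<bullet> x < b} \<or> T = {x. a \<bullet> x > b}"
    using assms by (auto simp: cut_def)
  show "D \<noteq> {}" "D \<subseteq> C"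
    using assms by (auto simp: cut_def)
  show "convex D" if "convex C"
    using T that by (auto intro!: convex_Int simp: convex_halfspace_lt convex_halfspace_gt)
  have "open T"
    using T(2) by (auto simp: open_halfspace_lt open_halfspace_gt)
  then show "openin (top_of_set Q) D" if "openin (top_of_set Q) C"
    using T that by (simp add: openin_Int_open)
qed

lemma cut_disjoint:
  assumes "D \<in> cut a b C" "D' \<in> cut a b C" "D \<noteq> D'"
  shows "disjnt D D'"
  using assms unfolding cut_def disjnt_def by (elim DiffE insertE emptyE) force+

text \<open>The invariant carried through successive cuts: convexity keeps the halves connected.
  Openness is relative to \<open>Q\<close> because pieces may contain boundary points of the closed
  cube.\<close>

definition tame :: "'a::euclidean_space set \<Rightarrow> 'a set set \<Rightarrow> bool" where
  "tame Q P \<longleftrightarrow> finite P \<and> (\<forall>C\<in>P. convex C \<and> openin (top_of_set Q) C)"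

lemma pieces_nonempty: "C \<in> pieces Q \<H> \<Longrightarrow> C \<noteq> {}"
  unfolding pieces_def by (rule in_components_nonempty)

lemma pieces_disjoint:
  "C \<in> pieces Q \<H> \<Longrightarrow> C' \<in> pieces Q \<H> \<Longrightarrow> C \<noteq> C' \<Longrightarrow> C \<inter> C' = {}"
  using components_eq[of C "Q - \<Union>\<H>" C'] by (auto simp: pieces_def)

lemma Union_pieces: "\<Union>(pieces Q \<H>) = Q - \<Union>\<H>"
  by (simp add: pieces_def)

text \<open>The nonempty halves of the old pieces satisfy the criterion
  \<open>components_eqI\<close>: they are convex, relatively open and pairwise disjoint, and they
  cover what remains.\<close>

lemma pieces_insert:
  assumes "tame Q (pieces Q \<H>)"
  shows "pieces Q (insert {x. a \<bullet> x = b} \<H>) = (\<Union>C\<in>pieces Q \<H>. cut a b C)"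
  unfolding pieces_def[of Q "insert _ _"]
proof (rule components_eqI)
  let ?S = "Q - \<Union>(insert {x. a \<bullet> x = b} \<H>)"
  have "\<Union>(\<Union>C\<in>pieces Q \<H>. cut a b C) = (\<Union>C\<in>pieces Q \<H>. \<Union>(cut a b C))"
    by blast
  also have "\<dots> = \<Union>(pieces Q \<H>) - {x. a \<bullet> x = b}"
    unfolding Union_cut by blast
  also have "\<dots> = ?S"
    unfolding Union_pieces by blast
  finally show un: "\<Union>(\<Union>C\<in>pieces Q \<H>. cut a b C) = ?S" .
  show "pairwise disjnt (\<Union>C\<in>pieces Q \<H>. cut a b C)"
  proof (rule pairwiseI)
    fix D D'
    assume "D \<in> (\<Union>C\<in>pieces Q \<H>. cut a b C)" "D' \<in> (\<Union>C\<in>pieces Q \<H>. cut a b C)" and ne: "D \<noteq> D'"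
    then obtain C C' where C: "C \<in> pieces Q \<H>" "D \<in> cut a b C" "C' \<in> pieces Q \<H>" "D' \<in> cut a b C'"
      by blast
    show "disjnt D D'"
    proof (cases "C = C'")
      case True
      then show ?thesis using C ne cut_disjoint by blast
    next
      case False
      then have "C \<inter> C' = {}"
        using C pieces_disjoint by blast
      then show ?thesis
        using cutD(2)[OF C(2)] cutD(2)[OF C(4)] by (auto simp: disjnt_def)
    qed
  qed
  fix D
  assume D: "D \<in> (\<Union>C\<in>pieces Q \<H>. cut a b C)"
  then obtain C where C: "C \<in> pieces Q \<H>" "D \<in> cut a b C"
    by blast
  have "convex C" "openin (top_of_set Q) C"
    using assms C(1) by (auto simp: tame_def)
  then have "convex D" "openin (top_of_set Q) D"
    using cutD[OF C(2)] by auto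
  moreover have "D \<subseteq> ?S"
    using D un by blast
  ultimately show "openin (top_of_set ?S) D \<and> connected D \<and> D \<noteq> {}"
    using cutD(1)[OF C(2)] convex_connected openin_subset_trans[of Q D ?S] by blast
qed

lemma tame_pieces_insert:
  assumes "tame Q (pieces Q \<H>)" "hyperplane H"
  shows "tame Q (pieces Q (insert H \<H>))"
proof -
  obtain a b where H: "H = {x. a \<bullet> x = b}"
    using assms(2) by (auto simp: hyperplane_def)
  have "convex D \<and> openin (top_of_set Q) D" if "C \<in> pieces Q \<H>" "D \<in> cut a b C" for C D
    using assms(1) that(1) cutD(3,4)[OF that(2)] by (auto simp: tame_def)
  moreover have "finite (pieces Q \<H>)"
    using assms(1) by (simp add: tame_def)
  ultimately show ?thesis
    unfolding H pieces_insert[OF assms(1)] tame_def by auto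
qed

lemma tame_pieces:
  assumes "convex Q" "finite \<H>" "\<forall>H\<in>\<H>. hyperplane H"
  shows "tame Q (pieces Q \<H>)"
  using assms(2,3)
proof (induction rule: finite_induct)
  case empty
  \<comment> \<open>Inclusion rather than equality, since an empty \<open>Q\<close> has no
    components.\<close>
  have "components Q \<subseteq> {Q}"
    using assms(1) convex_connected connected_eq_components_subset_sing by blast
  then show ?case
    using assms(1) finite_subset[of "components Q" "{Q}"] by (auto simp: tame_def pieces_def)
next
  case (insert H \<H>)
  then show ?case by (simp add: tame_pieces_insert)
qed

lemma card_pieces_insert:
  assumes "tame Q (pieces Q \<H>)"
  shows "card (pieces Q (insert {x. a \<bullet> x = b} \<H>)) = (\<Sum>C\<in>pieces Q \<H>. card (cut a b C))"
  unfolding pieces_insert[OF assms]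
proof (rule card_UN_disjoint)
  show "finite (pieces Q \<H>)"
    using assms by (simp add: tame_def)
  show "\<forall>C\<in>pieces Q \<H>. \<forall>C'\<in>pieces Q \<H>. C \<noteq> C' \<longrightarrow> cut a b C \<inter> cut a b C' = {}"
  proof (intro ballI impI)
    fix C C'
    assume "C \<in> pieces Q \<H>" "C' \<in> pieces Q \<H>" "C \<noteq> C'"
    then have "C \<inter> C' = {}"
      by (rule pieces_disjoint)
    \<comment> \<open>A common member would be a nonempty subset of two disjoint pieces.\<close>
    then have "D \<notin> cut a b C'" if "D \<in> cut a b C" for D
      using cutD(1,2)[OF that] cutD(2)[of D a b C'] by blast
    then show "cut a b C \<inter> cut a b C' = {}"
      by blast
  qed
qed simp

lemma card_pieces_insert_le:
  assumes "tame Q (pieces Q \<H>)" "hyperplane H"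
  shows "card (pieces Q (insert H \<H>)) \<le> 2 * card (pieces Q \<H>)"
proof -
  obtain a b where H: "H = {x. a \<bullet> x = b}"
    using assms(2) by (auto simp: hyperplane_def)
  have "(\<Sum>C\<in>pieces Q \<H>. card (cut a b C)) \<le> (\<Sum>C\<in>pieces Q \<H>. 2)"
    by (intro sum_mono card_cut_le)
  then show ?thesis
    unfolding H card_pieces_insert[OF assms(1)] by simp
qed

text \<open>\<open>Q\<close> lies in the closure of its interior, so an open set meeting
  \<open>Q\<close> also meets that interior. Hence even a piece touching the boundary of the cube
  contains a ball.\<close>

lemma openin_convex_interior_nonempty:
  fixes Q :: "'a::euclidean_space set"
  assumes "convex Q" "interior Q \<noteq> {}" "openin (top_of_set Q) C" "C \<noteq> {}"
  shows "interior C \<noteq> {}"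
proof -
  obtain T where T: "open T" "C = Q \<inter> T"
    using assms(3) by (auto simp: openin_open)
  then have "T \<inter> closure (interior Q) \<noteq> {}"
    using assms(4) closure_subset convex_closure_interior[OF assms(1,2)] by blast
  then have "T \<inter> interior Q \<noteq> {}"
    using open_Int_closure_eq_empty[OF T(1)] by blast
  moreover have "interior C = interior Q \<inter> T"
    using T by (simp add: interior_open)
  ultimately show ?thesis by blast
qed

text \<open>A hyperplane through the centre of a ball inside one piece splits that piece. Every
  other piece has interior points, so it is not swallowed by the hyperplane and leaves at least one
  half.\<close>

lemma exists_cutting_hyperplane:
  fixes Q :: "'a::euclidean_space set"
  assumes Q: "convex Q" "interior Q \<noteq> {}"
    and tame: "tame Q (pieces Q \<H>)" and ne: "pieces Q \<H> \<noteq> {}"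
  shows "\<exists>H. hyperplane H \<and> H \<notin> \<H> \<and> card (pieces Q \<H>) < card (pieces Q (insert H \<H>))"
proof -
  obtain C where C: "C \<in> pieces Q \<H>"
    using ne by blast
  have int: "interior D \<noteq> {}" if "D \<in> pieces Q \<H>" for D
    using openin_convex_interior_nonempty[OF Q] pieces_nonempty[OF that] that tame
    unfolding tame_def by blast
  then obtain p e where e: "e > 0" "ball p e \<subseteq> C"
    using C by (metis all_not_in_conv mem_interior)
  \<comment> \<open>A basis vector serves as normal: its norm is 1, so moving from \<open>p\<close>
    by \<open>e/2\<close> along it stays in the ball.\<close>
  obtain u :: 'a where u: "u \<in> Basis"
    using nonempty_Basis by blast
  define b where "b = u \<bullet> p"
  define H where "H = {x. u \<bullet> x = b}"
  have "u \<noteq> 0"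
    using u nonzero_Basis by blast
  then have "hyperplane H"
    unfolding hyperplane_def H_def by blast
  \<comment> \<open>The point \<open>p\<close> lies on \<open>H\<close> but, being in a piece, on no
    member of \<open>\<H>\<close>. So inserting \<open>H\<close> really raises the number of
    hyperplanes.\<close>
  moreover have "H \<notin> \<H>"
  proof -
    have "p \<in> Q - \<Union>\<H>"
      using e C Union_pieces[of Q \<H>] centre_in_ball[of p e] by blast
    moreover have "p \<in> H"
      by (simp add: H_def b_def)
    ultimately show ?thesis by blast
  qed
  moreover have "card (pieces Q \<H>) < card (pieces Q (insert H \<H>))"
  proof -
    have "1 \<le> card (cut u b D)" if D: "D \<in> pieces Q \<H>" for D
    proof -
      have "\<not> D \<subseteq> {x. u \<bullet> x = b}"
        using int[OF D] interior_mono[of D "{x. u \<bullet> x = b}"] interior_hyperplane[OF \<open>u \<noteq> 0\<close>] by auto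
      then have "cut u b D \<noteq> {}"
        using Union_cut[of u b D] by auto
      then show ?thesis
        by (simp add: Suc_le_eq card_gt_0_iff)
    qed
    moreover have "1 < card (cut u b C)"
    proof -
      have uu: "u \<bullet> u = 1" "norm u = 1"
        using u by auto
      have "p - (e/2) *\<^sub>R u \<in> ball p e" "p + (e/2) *\<^sub>R u \<in> ball p e"
        using e uu by (auto simp: dist_norm)
      then have mem: "p - (e/2) *\<^sub>R u \<in> C \<inter> {x. u \<bullet> x < b}" "p + (e/2) *\<^sub>R u \<in> C \<inter> {x. u \<bullet> x > b}"
        using e uu by (auto simp: b_def inner_diff_right inner_add_right)
      then have "cut u b C = {C \<inter> {x. u \<bullet> x < b}, C \<inter> {x. u \<bullet> x > b}}"
        unfolding cut_def by blast
      moreover have "C \<inter> {x. u \<bullet> x < b} \<noteq> C \<inter> {x. u \<bullet> x > b}"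
        using mem(1) by force
      ultimately show ?thesis by simp
    qed
    \<comment> \<open>Termwise comparison with the constant 1, strict at \<open>C\<close>.\<close>
    ultimately have "(\<Sum>D\<in>pieces Q \<H>. 1) < (\<Sum>D\<in>pieces Q \<H>. card (cut u b D))"
      using tame C by (intro sum_strict_mono_ex1) (auto simp: tame_def)
    then show ?thesis
      unfolding H_def card_pieces_insert[OF tame] by simp
  qed
  ultimately show ?thesis by blast
qed

section \<open>The maximal number of pieces\<close>

text \<open>Indexed by the number \<open>k\<close> of hyperplanes instead of
  \<open>N = k + 1\<close>, which avoids truncated subtraction.\<close>

definition piece_counts :: "'a::euclidean_space set \<Rightarrow> nat \<Rightarrow> nat set" where
  "piece_counts Q k =
     {card (pieces Q \<H>) | \<H>. finite \<H> \<and> card \<H> = k \<and> (\<forall>H\<in>\<H>. hyperplane H)}"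

lemma piece_counts_0:
  assumes "convex Q" "Q \<noteq> {}"
  shows "piece_counts Q 0 = {1}"
proof -
  have "components Q = {Q}"
    using assms by (simp add: components_eq_sing_iff convex_connected)
  then have "card (pieces Q {}) = 1"
    by (simp add: pieces_def)
  moreover have "piece_counts Q 0 = {card (pieces Q {})}"
    unfolding piece_counts_def by (auto simp: card_eq_0_iff)
  ultimately show ?thesis by simp
qed

text \<open>Remove any one hyperplane from the arrangement; restoring it at most doubles the
  count.\<close>

lemma piece_counts_Suc_le:
  assumes "convex Q" "n \<in> piece_counts Q (Suc k)"
  shows "\<exists>m\<in>piece_counts Q k. n \<le> 2 * m"
proof -
  obtain \<H> where \<H>: "finite \<H>" "card \<H> = Suc k" "\<forall>H\<in>\<H>. hyperplane H" "n = card (pieces Q \<H>)"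
    using assms(2) by (auto simp: piece_counts_def)
  then obtain H \<G> where \<G>: "\<H> = insert H \<G>" "H \<notin> \<G>" "card \<G> = k" "finite \<G>"
    by (metis card_Suc_eq finite_insert)
  have "n \<le> 2 * card (pieces Q \<G>)"
    using \<H> \<G> assms(1) by (simp add: card_pieces_insert_le tame_pieces)
  moreover have "card (pieces Q \<G>) \<in> piece_counts Q k"
    using \<H> \<G> by (auto simp: piece_counts_def)
  ultimately show ?thesis by blast
qed

lemma piece_counts_Suc_greater:
  fixes Q :: "'a::euclidean_space set"
  assumes Q: "convex Q" "interior Q \<noteq> {}" and "m \<in> piece_counts Q k" "m > 0"
  shows "\<exists>n\<in>piece_counts Q (Suc k). m < n"
proof -
  obtain \<H> where \<H>: "finite \<H>" "card \<H> = k" "\<forall>H\<in>\<H>. hyperplane H" "m = card (pieces Q \<H>)"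
    using assms(3) unfolding piece_counts_def by blast
  then have "pieces Q \<H> \<noteq> {}"
    using assms(4) by auto
  then obtain H where H: "hyperplane H" "H \<notin> \<H>" "m < card (pieces Q (insert H \<H>))"
    using exists_cutting_hyperplane[OF Q tame_pieces[OF Q(1) \<H>(1,3)]] \<H>(4) by auto
  have "card (pieces Q (insert H \<H>)) \<in> piece_counts Q (Suc k)"
    unfolding piece_counts_def
    by (intro CollectI exI[of _ "insert H \<H>"]) (use \<H> H in auto)
  with H show ?thesis by blast
qed

text \<open>Iterated doubling from 1 gives the bound \<open>2 ^ k\<close>; finiteness is what makes
  \<open>Max\<close> a genuine maximum.\<close>

lemma finite_piece_counts:
  assumes "convex Q" "Q \<noteq> {}"
  shows "finite (piece_counts Q k)"
proof -
  have "piece_counts Q k \<subseteq> {..2 ^ k}"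
  proof (induction k)
    case 0
    then show ?case using piece_counts_0[OF assms] by simp
  next
    case (Suc k)
    show ?case
    proof
      fix n
      assume "n \<in> piece_counts Q (Suc k)"
      then obtain m where "m \<in> piece_counts Q k" "n \<le> 2 * m"
        using piece_counts_Suc_le[OF assms(1)] by blast
      with Suc.IH show "n \<in> {..2 ^ Suc k}"
        by force
    qed
  qed
  then show ?thesis
    using finite_subset by blast
qed

text \<open>Supplies nonemptiness for \<open>Max\<close> and a positive maximum, so that an optimal
  arrangement has a piece to cut.\<close>

lemma piece_counts_positive:
  fixes Q :: "'a::euclidean_space set"
  assumes "convex Q" "interior Q \<noteq> {}"
  shows "\<exists>m\<in>piece_counts Q k. m > 0"
proof (induction k)
  case 0
  have "Q \<noteq> {}"
    using assms(2) by auto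
  then show ?case
    using piece_counts_0[OF assms(1)] by simp
next
  case (Suc k)
  then obtain m where "m \<in> piece_counts Q k" "m > 0"
    by blast
  then obtain n where "n \<in> piece_counts Q (Suc k)" "m < n"
    using piece_counts_Suc_greater[OF assms] by blast
  then show ?case
    by (intro bexI[of _ n]) auto
qed

lemma max_pieces_eq: "max_pieces TYPE('n::finite) N = Max (piece_counts (cbox 0 (1 :: real^'n)) (N - 1))"
  by (simp add: max_pieces_def piece_counts_def)

theorem theorem2:
  assumes "CARD('n::finite) \<in> {1, 2, 3, 4}"
  shows "semicomplete (\<lambda>N. int (max_pieces TYPE('n) N))"
proof (rule semicomplete_of_doubling)
  let ?Q = "cbox 0 (1 :: real^'n)"
  have Q: "convex ?Q" "interior ?Q \<noteq> {}"
    by (simp_all add: interior_cbox interval_ne_empty_cart)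
  then have ne: "?Q \<noteq> {}"
    by (metis interior_empty)
  note fin = finite_piece_counts[OF Q(1) ne]
  show "int (max_pieces TYPE('n) 1) = 1"
    using piece_counts_0[OF Q(1) ne] by (simp add: max_pieces_eq)
  fix i :: nat
  assume "i \<ge> 1"
  then obtain k where i: "i = Suc k"
    by (cases i) auto
  obtain m where m: "m \<in> piece_counts ?Q k" "m > 0"
    using piece_counts_positive[OF Q] by blast
  have max: "Max (piece_counts ?Q k) \<in> piece_counts ?Q k"
    using m(1) fin by (intro Max_in) auto
  have "Max (piece_counts ?Q k) > 0"
    using m(2) Max_ge[OF fin m(1)] by linarith
  \<comment> \<open>Extend an optimal arrangement of \<open>k\<close> hyperplanes by a cutting
    one.\<close>
  then obtain n where n: "n \<in> piece_counts ?Q (Suc k)" "Max (piece_counts ?Q k) < n"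
    using piece_counts_Suc_greater[OF Q max] by blast
  then have "Max (piece_counts ?Q k) < Max (piece_counts ?Q (Suc k))"
    using Max_ge[OF fin n(1)] by linarith
  then show "int (max_pieces TYPE('n) i) < int (max_pieces TYPE('n) (Suc i))"
    by (simp add: max_pieces_eq i)
  have "Max (piece_counts ?Q (Suc k)) \<in> piece_counts ?Q (Suc k)"
    using n(1) fin by (intro Max_in) auto
  \<comment> \<open>Conversely, shrink an optimal arrangement of \<open>Suc k\<close> hyperplanes by
    one.\<close>
  then obtain l where l: "l \<in> piece_counts ?Q k" "Max (piece_counts ?Q (Suc k)) \<le> 2 * l"
    using piece_counts_Suc_le[OF Q(1)] by blast
  then have "Max (piece_counts ?Q (Suc k)) \<le> 2 * Max (piece_counts ?Q k)"
    using Max_ge[OF fin l(1)] by linarith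
  then show "int (max_pieces TYPE('n) (Suc i)) \<le> 2 * int (max_pieces TYPE('n) i)"
    by (simp add: max_pieces_eq i)
qed

end
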